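(* Let $A,B,C,D\in\mathbb{C}^{n\times n}$ and let $M=\begin{pmatrix}A&B\\C&D\end{pmatrix}\in\mathbb{C}^{2n\times 2n}$. Suppose that the group inverse $A^{\#}$ exists, set $K=D-CA^{\#}B$, and suppose that the group inverse $K^{\#}$ exists. Then the following two conditions are equivalent: (a) $R(C^* )\subseteq R(A^* )$, $R(B)\subseteq R(A)$, $R(C)\subseteq R(K)$ and $R(B^* )\subseteq R(K^* )$; (b) the group inverse $M^{\#}$ exists and is given by $$M^{\#}=\begin{pmatrix}A^{\#}+A^{\#}BK^{\#}CA^{\#} & -A^{\#}BK^{\#}\\ -K^{\#}CA^{\#} & K^{\#}\end{pmatrix}.$$
   Context: For a square complex matrix $T$, the group inverse $T^{\#}$ (if it exists) is the unique matrix $X$ with $TXT=T$, $XTX=X$ and $TX=XT$. $R(T)$ denotes the range (column space) of $T$ and $T^*$ the conjugate transpose of $T$. *)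

theory Defs
  imports
    "Jordan_Normal_Form.Schur_Decomposition"
    "Jordan_Normal_Form.DL_Rank"
begin

definition is_group_inverse :: "'a :: semiring_1 mat \<Rightarrow> 'a mat \<Rightarrow> bool" where
  "is_group_inverse T X \<longleftrightarrow>
     square_mat T \<and> X \<in> carrier_mat (dim_row T) (dim_row T) \<and>
     T * X * T = T \<and> X * T * X = X \<and> T * X = X * T"

definition has_group_inverse :: "'a :: semiring_1 mat \<Rightarrow> bool" where
  "has_group_inverse T \<longleftrightarrow> (\<exists>X. is_group_inverse T X)"

text \<open>The value is unspecified unless \<^term>\<open>has_group_inverse T\<close> holds; in that case
  \<open>group_inverse_eqI\<close> below shows that it is the group inverse.\<close>

definition group_inverse :: "'a :: semiring_1 mat \<Rightarrow> 'a mat" ("_\<^sup>#" [1000] 1000) where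
  "T\<^sup># = (THE X. is_group_inverse T X)"

lemma is_group_inverse_unique:
  assumes "is_group_inverse T X" and "is_group_inverse T Y"
  shows "X = Y"
proof -
  define n where "n = dim_row T"
  have T: "T \<in> carrier_mat n n" and X: "X \<in> carrier_mat n n" and Y: "Y \<in> carrier_mat n n"
    using assms by (auto simp: is_group_inverse_def n_def)
  have TX: "T * X = X * T" "T * X * T = T" "X * T * X = X"
    and TY: "T * Y = Y * T" "T * Y * T = T" "Y * T * Y = Y"
    using assms by (auto simp: is_group_inverse_def)
  have "X * T = T * Y * T * X" using TX TY by simp
  also have "\<dots> = (T * Y) * (T * X)" using T X Y by (simp add: assoc_mult_mat[of _ n n _ n _ n])
  also have "\<dots> = (Y * T) * (X * T)" using TX TY by simp
  also have "\<dots> = Y * (T * X * T)" using T X Y by (simp add: assoc_mult_mat[of _ n n _ n _ n])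
  finally have XT: "X * T = Y * T" using TX by simp
  have "X = Y * T * X" using TX XT by simp
  also have "\<dots> = Y * (T * X)" using T X Y by (simp add: assoc_mult_mat[of _ n n _ n _ n])
  also have "\<dots> = Y * (T * Y)" using TX(1) TY(1) XT by simp
  also have "\<dots> = Y * T * Y" using T Y by (simp add: assoc_mult_mat[of _ n n _ n _ n])
  finally show ?thesis using TY by simp
qed

lemma group_inverse_eqI: "is_group_inverse T X \<Longrightarrow> T\<^sup># = X"
  unfolding group_inverse_def using is_group_inverse_unique by blast

abbreviation mat_range :: "'a :: field mat \<Rightarrow> 'a vec set" where
  "mat_range T \<equiv> vec_space.col_space (dim_row T) T"

end

theory Submission
  imports Defs
begin

text \<open>Writing \<open>a = A\<^sup>#\<close> and \<open>k = K\<^sup>#\<close>, the four range inclusions say \<open>C a A = C\<close>, \<open>A a B = B\<close>,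
  \<open>K k C = C\<close> and \<open>B k K = B\<close>. Since \<open>D = K + C a B\<close>, these identities make \<open>M X\<close> and \<open>X M\<close>
  both equal to \<open>diag (A a, K k)\<close>, where \<open>X\<close> is the proposed inverse. Conversely, comparing the
  off-diagonal blocks of \<open>M X = X M\<close>, and multiplying from the left by the idempotents \<open>A a\<close> and
  \<open>K k\<close>, forces \<open>M X\<close> to be this block diagonal matrix, and then \<open>M X M = M\<close> gives back
  the four identities.\<close>

section \<open>Range inclusions as matrix identities\<close>

lemma mat_range_subset_iff_factor:
  fixes A B :: "'a :: field mat"
  assumes A: "A \<in> carrier_mat n m" and B: "B \<in> carrier_mat n p"
  shows "mat_range B \<subseteq> mat_range A \<longleftrightarrow> (\<exists>Y \<in> carrier_mat m p. B = A * Y)"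
proof
  have range: "mat_range T = {y \<in> carrier_vec n. \<exists>x \<in> carrier_vec q. T *\<^sub>v x = y}"
    if "T \<in> carrier_mat n q" for T :: "'a mat" and q
    using vec_space.col_space_eq[OF that] that by auto
  note ranges = range[OF A] range[OF B]
  show "\<exists>Y \<in> carrier_mat m p. B = A * Y" if sub: "mat_range B \<subseteq> mat_range A"
  proof -
    have "\<exists>x \<in> carrier_vec m. A *\<^sub>v x = col B j" if j: "j < p" for j
    proof -
      \<comment> \<open>Unit vectors place each column of \<open>B\<close> in its range, hence in
        that of \<open>A\<close>; the chosen preimages \<open>f j\<close> become the columns of the
        factor.\<close>
      have "B *\<^sub>v unit_vec p j = col B j"
        using B j by (intro eq_vecI) auto
      then have "col B j \<in> mat_range B"
        using B ranges by (auto intro!: bexI[of _ "unit_vec p j"])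
      then show ?thesis using sub ranges by auto
    qed
    then obtain f where f: "\<And>j. j < p \<Longrightarrow> f j \<in> carrier_vec m \<and> A *\<^sub>v f j = col B j"
      by metis
    have "B = A * mat_of_cols m (map f [0..<p])"
    proof (rule mat_col_eqI)
      fix j assume "j < dim_col (A * mat_of_cols m (map f [0..<p]))"
      then have j: "j < p" by simp
      have "col (A * mat_of_cols m (map f [0..<p])) j = A *\<^sub>v col (mat_of_cols m (map f [0..<p])) j"
        using A j by (intro col_mult2[of _ n m _ p]) auto
      with f[OF j] j show "col B j = col (A * mat_of_cols m (map f [0..<p])) j" by simp
    qed (use A B in auto)
    then show ?thesis by (intro bexI[of _ "mat_of_cols m (map f [0..<p])"]) auto
  qed
  show "mat_range B \<subseteq> mat_range A" if "\<exists>Y \<in> carrier_mat m p. B = A * Y"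
  proof -
    from that obtain Y where Y: "Y \<in> carrier_mat m p" and BY: "B = A * Y" by auto
    show ?thesis
      unfolding ranges using A Y by (auto simp: BY intro!: bexI[of _ "Y *\<^sub>v _"])
  qed
qed

text \<open>If \<open>B = A * Y\<close>, then \<open>A * G * A = A\<close> gives
  \<open>A * G * B = B\<close>; conversely \<open>G * B\<close> serves as the factor. A group
  inverse is such a \<open>G\<close>.\<close>

lemma mat_range_subset_iff_inner_inverse:
  fixes A B G :: "'a :: field mat"
  assumes A: "A \<in> carrier_mat n m" and B: "B \<in> carrier_mat n p"
    and G: "G \<in> carrier_mat m n" and AGA: "A * G * A = A"
  shows "mat_range B \<subseteq> mat_range A \<longleftrightarrow> A * G * B = B"
proof -
  have "A * G * B = B" if "Y \<in> carrier_mat m p" "B = A * Y" for Y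
  proof -
    have "A * G * (A * Y) = A * G * A * Y"
      using A G that(1)
      by (simp add: assoc_mult_mat[of _ n m _ n _ p] assoc_mult_mat[of _ n m _ n _ m]
          assoc_mult_mat[of _ m n _ m _ p] assoc_mult_mat[of _ n m _ m _ p])
    then show ?thesis using AGA that(2) by simp
  qed
  moreover have "A * G * B = A * (G * B)" using A G B by simp
  ultimately show ?thesis
    unfolding mat_range_subset_iff_factor[OF A B] using G B by (metis mult_carrier_mat)
qed

section \<open>Conjugate transposes\<close>

lemma mat_adjoint_carrier [simp]:
  "A \<in> carrier_mat n m \<Longrightarrow> mat_adjoint A \<in> carrier_mat m n"
  unfolding mat_adjoint_def by auto

lemma mat_adjoint_index [simp]:
  "i < dim_col A \<Longrightarrow> j < dim_row A \<Longrightarrow> mat_adjoint A $$ (i, j) = conjugate (A $$ (j, i))"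
  unfolding mat_adjoint_def by (simp add: mat_of_rows_index)

lemma mat_adjoint_dim [simp]:
  "dim_row (mat_adjoint A) = dim_col A" "dim_col (mat_adjoint A) = dim_row A"
  unfolding mat_adjoint_def by auto

lemma mat_adjoint_adjoint [simp]: "mat_adjoint (mat_adjoint A) = A"
  by (rule eq_matI) auto

lemma mat_adjoint_mult:
  fixes A B :: "'a :: conjugatable_field mat"
  assumes "A \<in> carrier_mat n m" and "B \<in> carrier_mat m p"
  shows "mat_adjoint (A * B) = mat_adjoint B * mat_adjoint A"
  using assms
  by (intro eq_matI)
    (auto simp: scalar_prod_def conjugate_dist_mul sum_conjugate mult.commute intro!: sum.cong)

text \<open>The adjoint of \<open>G\<close> is an inner inverse of the adjoint of \<open>A\<close>,
  so the previous criterion applies; taking adjoints of the resulting identity reverses the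
  products.\<close>

lemma mat_range_adjoint_subset_iff_inner_inverse:
  fixes A C G :: "'a :: conjugatable_field mat"
  assumes A: "A \<in> carrier_mat n m" and C: "C \<in> carrier_mat p m"
    and G: "G \<in> carrier_mat m n" and AGA: "A * G * A = A"
  shows "mat_range (mat_adjoint C) \<subseteq> mat_range (mat_adjoint A) \<longleftrightarrow> C * G * A = C"
proof -
  \<comment> \<open>\<open>T = A\<close> yields the inner inverse property, \<open>T = C\<close> the
    criterion itself.\<close>
  have adj: "mat_adjoint A * mat_adjoint G * mat_adjoint T = mat_adjoint (T * G * A)"
    if T: "T \<in> carrier_mat q m" for T q
  proof -
    have "mat_adjoint (T * G * A) = mat_adjoint A * (mat_adjoint G * mat_adjoint T)"
      using T G A by (simp add: mat_adjoint_mult[of _ q n _ m] mat_adjoint_mult[of _ q m _ n]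
          del: assoc_mult_mat)
    then show ?thesis
      using T G A by (simp add: assoc_mult_mat[of _ m n _ m _ q])
  qed
  show ?thesis
    using mat_range_subset_iff_inner_inverse[of "mat_adjoint A" m n "mat_adjoint C" p "mat_adjoint G"]
      A C G adj[OF A] adj[OF C] AGA mat_adjoint_adjoint by (metis mat_adjoint_carrier)
qed

section \<open>Comparing block matrices\<close>

lemma split_block_four_block_mat:
  assumes "A \<in> carrier_mat nr1 nc1" "B \<in> carrier_mat nr1 nc2"
    "C \<in> carrier_mat nr2 nc1" "D \<in> carrier_mat nr2 nc2"
  shows "split_block (four_block_mat A B C D) nr1 nc1 = (A, B, C, D)"
  unfolding split_block_def Let_def prod.inject
  by (intro conjI eq_matI; use assms in simp)

lemma four_block_mat_inject:
  assumes "A \<in> carrier_mat nr1 nc1" "B \<in> carrier_mat nr1 nc2"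
    "C \<in> carrier_mat nr2 nc1" "D \<in> carrier_mat nr2 nc2"
    and "A' \<in> carrier_mat nr1 nc1" "B' \<in> carrier_mat nr1 nc2"
    "C' \<in> carrier_mat nr2 nc1" "D' \<in> carrier_mat nr2 nc2"
  shows "four_block_mat A B C D = four_block_mat A' B' C' D' \<longleftrightarrow>
    A = A' \<and> B = B' \<and> C = C' \<and> D = D'"
  using split_block_four_block_mat[OF assms(1-4)] split_block_four_block_mat[OF assms(5-8)]
  by (metis prod.inject)

lemma mat_minus_eq_0_imp_eq:
  fixes S T :: "'a :: group_add mat"
  assumes "S \<in> carrier_mat n m" and "T \<in> carrier_mat n m" and "S - T = 0\<^sub>m n m"
  shows "S = T"
proof (rule eq_matI)
  fix i j assume ij: "i < dim_row T" "j < dim_col T"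
  then have "(S - T) $$ (i, j) = 0" using assms by simp
  then show "S $$ (i, j) = T $$ (i, j)" using ij by simp
qed (use assms in auto)

section \<open>Block products in terms of the Schur complement\<close>

locale schur_group_inverse =
  fixes n :: nat and A B C K a k :: "'a :: ring_1 mat"
  assumes carrier [simp]: "A \<in> carrier_mat n n" "B \<in> carrier_mat n n" "C \<in> carrier_mat n n"
      "K \<in> carrier_mat n n"
    and A_inv: "is_group_inverse A a" and K_inv: "is_group_inverse K k"
begin

text \<open>The lower right block is \<open>D\<close> solved from \<open>K = D - C * a * B\<close>,
  so that \<open>K\<close> is a parameter and the terms in \<open>C * a * B\<close> cancel in
  products.\<close>

definition "block = four_block_mat A B C (K + C * a * B)"

definition "block_inv = four_block_mat (a + a * B * k * C * a) (- (a * B * k)) (- (k * C * a)) k"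

lemma inv_carrier [simp]: "a \<in> carrier_mat n n" "k \<in> carrier_mat n n"
  using A_inv K_inv carrier by (auto simp: is_group_inverse_def)

lemma op_carrier [simp]:
  assumes "S \<in> carrier_mat n n" and "T \<in> carrier_mat n n"
  shows "S * T \<in> carrier_mat n n" and "S + T \<in> carrier_mat n n" and "S - T \<in> carrier_mat n n"
  using assms by (simp_all add: minus_carrier_mat)

lemmas dims [simp] = carrier[THEN carrier_matD(1)] carrier[THEN carrier_matD(2)]
  inv_carrier[THEN carrier_matD(1)] inv_carrier[THEN carrier_matD(2)]

lemmas assoc = assoc_mult_mat[of _ n n _ n _ n]

lemmas distribs = add_mult_distrib_mat[of _ n n _ _ n] mult_add_distrib_mat[of _ n n _ n]
  minus_mult_distrib_mat[of _ n n _ _ n] mult_minus_distrib_mat[of _ n n _ n]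

lemma inv_eqs: "A * (a * A) = A" "a * (A * a) = a" "a * A = A * a"
    "K * (k * K) = K" "k * (K * k) = k" "k * K = K * k"
  using A_inv K_inv by (auto simp: is_group_inverse_def assoc)

lemma block_mult_inv:
  "block * block_inv = four_block_mat
    (A * a + (A * a * B * k * C * a - B * k * C * a))
    (B * k - A * a * B * k) (C * a - K * k * C * a) (K * k)"
  unfolding block_def block_inv_def
  \<comment> \<open>Entrywise comparison reduces the additive cancellations to scalars; matrix
    products stay unexpanded because \<open>index_mult_mat(1)\<close> is removed.\<close>
  by (subst mult_four_block_mat[of _ n n _ n _ n _ _ n _ n];
      (intro cong_four_block_mat eq_matI)?; simp add: assoc distribs del: index_mult_mat(1))

lemma inv_mult_block:
  "block_inv * block = four_block_mat
    (a * A + (a * B * k * C * a * A - a * B * k * C))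
    (a * B - a * B * k * K) (k * C - k * C * a * A) (k * K)"
  unfolding block_def block_inv_def
  by (subst mult_four_block_mat[of _ n n _ n _ n _ _ n _ n];
      (intro cong_four_block_mat eq_matI)?; simp add: assoc distribs del: index_mult_mat(1))

text \<open>Rewrite rules for right-nested products: commutation moves \<open>A\<close> before
  \<open>a\<close> and \<open>K\<close> before \<open>k\<close>, after which the inverse laws
  cancel. The trailing \<open>Z\<close> lets them act inside longer products.\<close>

lemma inv_cancel:
  "A * (A * a) = A" "A * (a * a) = a" "K * (K * k) = K" "K * (k * k) = k"
  "Z \<in> carrier_mat n n \<Longrightarrow> a * (A * Z) = A * (a * Z)"
  "Z \<in> carrier_mat n n \<Longrightarrow> k * (K * Z) = K * (k * Z)"
  "Z \<in> carrier_mat n n \<Longrightarrow> A * (a * (a * Z)) = a * Z"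
  "Z \<in> carrier_mat n n \<Longrightarrow> K * (k * (k * Z)) = k * Z"
proof -
  show 1: "A * (A * a) = A" "A * (a * a) = a" "K * (K * k) = K" "K * (k * k) = k"
    using inv_eqs by (simp_all flip: assoc)
  assume Z: "Z \<in> carrier_mat n n"
  have "a * A * Z = A * a * Z" "k * K * Z = K * k * Z" using inv_eqs by simp_all
  then show "a * (A * Z) = A * (a * Z)" "k * (K * Z) = K * (k * Z)"
    using Z by (simp_all add: assoc)
  have "A * (a * a) * Z = a * Z" "K * (k * k) * Z = k * Z" using 1 by simp_all
  then show "A * (a * (a * Z)) = a * Z" "K * (k * (k * Z)) = k * Z"
    using Z by (simp_all add: assoc)
qed

lemma block_carrier [simp]:
  "block \<in> carrier_mat (n + n) (n + n)"
  "block_inv \<in> carrier_mat (n + n) (n + n)"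
  unfolding block_def block_inv_def by (intro four_block_carrier_mat; simp)+

text \<open>The idempotent that both products of \<open>block\<close> and \<open>block_inv\<close>
  equal once these commute.\<close>

definition "diag_proj = four_block_mat (A * a) (0\<^sub>m n n) (0\<^sub>m n n) (K * k)"

lemma diag_proj_mult_block:
  "diag_proj * block = four_block_mat A (A * a * B) (K * k * C) (K + K * k * C * a * B)"
  unfolding diag_proj_def block_def
  by (subst mult_four_block_mat[of _ n n _ n _ n _ _ n _ n])
    (simp_all add: assoc distribs inv_cancel inv_eqs)

lemma block_mult_diag_proj:
  "block * diag_proj = four_block_mat A (B * k * K) (C * a * A) (K + C * a * B * k * K)"
  unfolding diag_proj_def block_def
  by (subst mult_four_block_mat[of _ n n _ n _ n _ _ n _ n])
    (simp_all add: assoc distribs inv_cancel inv_eqs)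

lemma block_mult_inv_if_commute:
  assumes "block * block_inv = block_inv * block"
  shows "block * block_inv = diag_proj"
proof -
  have e: "B * k - A * a * B * k = a * B - a * B * k * K"
    "C * a - K * k * C * a = k * C - k * C * a * A"
    using assms unfolding block_mult_inv inv_mult_block
    by (subst (asm) four_block_mat_inject[of _ n n _ n _ n]; simp)+
  \<comment> \<open>The block from \<open>block_inv * block\<close> begins with \<open>a\<close> and
    is fixed by \<open>A * a\<close>; its counterpart from \<open>block * block_inv\<close> is
    annihilated. Being equal, both vanish.\<close>
  have "a * B - a * B * k * K = A * a * (a * B - a * B * k * K)"
    by (simp add: assoc distribs inv_cancel)
  also have "\<dots> = A * a * (B * k - A * a * B * k)" using e by simp
  also have "\<dots> = 0\<^sub>m n n" by (simp add: assoc distribs inv_cancel)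
  finally have 1: "B * k - A * a * B * k = 0\<^sub>m n n" using e by simp
  have "k * C - k * C * a * A = K * k * (k * C - k * C * a * A)"
    by (simp add: assoc distribs inv_cancel)
  also have "\<dots> = K * k * (C * a - K * k * C * a)" using e by simp
  also have "\<dots> = 0\<^sub>m n n" by (simp add: assoc distribs inv_cancel)
  finally have 2: "C * a - K * k * C * a = 0\<^sub>m n n" using e by simp
  \<comment> \<open>This also removes the correction term in the upper left block.\<close>
  have "A * a * B * k = B * k" using mat_minus_eq_0_imp_eq[OF _ _ 1] by simp
  then show ?thesis unfolding block_mult_inv diag_proj_def 1 2
    by (simp add: minus_r_inv_mat[of _ n n] right_add_zero_mat[of _ n n])
qed

lemma is_group_inverse_block_iff:
  "is_group_inverse block block_inv \<longleftrightarrow>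
    C * a * A = C \<and> A * a * B = B \<and> K * k * C = C \<and> B * k * K = B" (is "_ \<longleftrightarrow> ?R")
proof
  assume inv: "is_group_inverse block block_inv"
  then have comm: "block * block_inv = block_inv * block"
    and MXM: "block * block_inv * block = block"
    by (auto simp: is_group_inverse_def)
  note P = block_mult_inv_if_commute[OF comm]
  have "diag_proj * block = block" using MXM P by simp
  moreover have "block * diag_proj = block * (block_inv * block)" using P comm by metis
  then have "block * diag_proj = block"
    using MXM assoc_mult_mat[OF block_carrier(1,2,1)] by metis
  ultimately show ?R
    \<comment> \<open>Left absorption of the idempotent gives the identities for
      \<open>A * a * B\<close> and \<open>K * k * C\<close>, right absorption the other two.\<close>
    unfolding diag_proj_mult_block block_mult_diag_proj unfolding block_def
    by (subst (asm) (1 2) four_block_mat_inject[of _ n n _ n _ n]; simp)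
next
  assume R: ?R
  then have R': "C * (A * a) = C" "A * (a * B) = B" "K * (k * C) = C" "B * (K * k) = B"
    by (auto simp: assoc inv_eqs)
  have cancel: "A * (a * (B * Z)) = B * Z" "K * (k * (C * Z)) = C * Z"
    if Z: "Z \<in> carrier_mat n n" for Z
  proof -
    have "A * a * B * Z = B * Z" "K * k * C * Z = C * Z" using R by simp_all
    then show "A * (a * (B * Z)) = B * Z" "K * (k * (C * Z)) = C * Z"
      using Z by (simp_all add: assoc)
  qed
  have MX: "block * block_inv = diag_proj" and XM: "block_inv * block = diag_proj"
    unfolding block_mult_inv inv_mult_block diag_proj_def
    by (simp_all add: assoc inv_eqs inv_cancel R' cancel minus_r_inv_mat[of _ n n]
        right_add_zero_mat[of _ n n])
  have PM: "diag_proj * block = block"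
    unfolding diag_proj_mult_block unfolding block_def using R by simp
  \<comment> \<open>Every block in the first row of \<open>block_inv\<close> starts with
    \<open>a\<close>, in the second with \<open>k\<close>, up to sign; \<open>A * a\<close> and
    \<open>K * k\<close> fix these.\<close>
  have PX: "diag_proj * block_inv = block_inv"
    unfolding diag_proj_def block_inv_def
    by (subst mult_four_block_mat[of _ n n _ n _ n _ _ n _ n];
        (intro cong_four_block_mat eq_matI)?;
        simp add: assoc distribs inv_cancel del: index_mult_mat(1))
  show "is_group_inverse block block_inv"
    unfolding is_group_inverse_def MX XM PM PX
    using block_carrier by (simp add: carrier_matD[OF block_carrier(1)])
qed

end

text \<open>By uniqueness, condition (b) becomes a statement about the defining equations
  alone.\<close>

lemma has_group_inverse_and_eq_iff:
  "has_group_inverse T \<and> T\<^sup># = X \<longleftrightarrow> is_group_inverse T X"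
  unfolding has_group_inverse_def using group_inverse_eqI by blast

theorem theorem2p1:
  fixes n :: nat and A B C D M K :: "complex mat"
  assumes "A \<in> carrier_mat n n" and "B \<in> carrier_mat n n"
    and "C \<in> carrier_mat n n" and "D \<in> carrier_mat n n"
    and "M = four_block_mat A B C D"
    and "has_group_inverse A"
    and "K = D - C * A\<^sup># * B"
    and "has_group_inverse K"
  shows
    "(mat_range (mat_adjoint C) \<subseteq> mat_range (mat_adjoint A) \<and>
      mat_range B \<subseteq> mat_range A \<and>
      mat_range C \<subseteq> mat_range K \<and>
      mat_range (mat_adjoint B) \<subseteq> mat_range (mat_adjoint K))
     \<longleftrightarrow>
     (has_group_inverse M \<and>
      M\<^sup># = four_block_mat
              (A\<^sup># + A\<^sup># * B * K\<^sup># * C * A\<^sup>#) (- (A\<^sup># * B * K\<^sup>#))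
              (- (K\<^sup># * C * A\<^sup>#)) (K\<^sup>#))"
proof -
  note A = assms(1) and B = assms(2) and C = assms(3) and D = assms(4)
  have inv: "is_group_inverse A (A\<^sup>#)" "is_group_inverse K (K\<^sup>#)"
    using assms(6,8) has_group_inverse_and_eq_iff by blast+
  have a: "A\<^sup># \<in> carrier_mat n n" using inv(1) A by (auto simp: is_group_inverse_def)
  have CaB: "C * A\<^sup># * B \<in> carrier_mat n n" using a B C by auto
  then have K: "K \<in> carrier_mat n n" unfolding assms(7) by (rule minus_carrier_mat)
  then have k: "K\<^sup># \<in> carrier_mat n n" using inv(2) by (auto simp: is_group_inverse_def)
  interpret schur_group_inverse n A B C K "A\<^sup>#" "K\<^sup>#"
    by unfold_locales (fact A B C K inv)+
  have "D = K + C * A\<^sup># * B"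
    unfolding assms(7) using D CaB by (intro eq_matI) auto
  then have M: "M = block" unfolding assms(5) block_def by simp
  have AaA: "A * A\<^sup># * A = A" and KkK: "K * K\<^sup># * K = K"
    using inv by (auto simp: is_group_inverse_def)
  \<comment> \<open>The four inclusions turn into the four identities of
    \<open>is_group_inverse_block_iff\<close>, in the same order.\<close>
  show ?thesis
    unfolding has_group_inverse_and_eq_iff M
      is_group_inverse_block_iff[unfolded block_inv_def]
      mat_range_subset_iff_inner_inverse[OF A B a AaA]
      mat_range_subset_iff_inner_inverse[OF K C k KkK]
      mat_range_adjoint_subset_iff_inner_inverse[OF A C a AaA]
      mat_range_adjoint_subset_iff_inner_inverse[OF K B k KkK] ..
qed

end
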